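(* For every integer $n>2$ and every set $G\subseteq V(\mathrm{Sh}_n^2)$ we have $$\alpha(\mathrm{Sh}_n^2[G])\ge \frac14|G|.$$
   Context: For an integer $n>2$, the shift graph $\mathrm{Sh}_n^2$ is the graph with vertex set $V(\mathrm{Sh}_n^2)=\{(x_1,x_2): 1\le x_1<x_2\le n\}$ (with $x_1,x_2$ integers) in which two vertices $(x_1,x_2)$ and $(y_1,y_2)$ are adjacent if $x_1=y_2$ or $y_1=x_2$. For $G\subseteq V(\mathrm{Sh}_n^2)$, $\mathrm{Sh}_n^2[G]$ denotes the subgraph of $\mathrm{Sh}_n^2$ induced by $G$, $|G|$ is the cardinality of $G$, and $\alpha(H)$ denotes the independence number (maximum size of an independent set of vertices) of a graph $H$. *)

theory Defs
  imports Complex_Main "Graph_Theory.Graph_Theory"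
begin

text \<open>
  A simple graph is a symmetric loop-free digraph (locale \<^locale>\<open>graph\<close>, or
  \<^locale>\<open>pair_graph\<close> when arcs are pairs of vertices), so each undirected edge
  contributes both of its orientations to the arcs.
\<close>

definition shift_graph :: "int \<Rightarrow> (int \<times> int) pair_pre_digraph" where
  "shift_graph n = (let V = {(x1, x2). 1 \<le> x1 \<and> x1 < x2 \<and> x2 \<le> n} in
     \<lparr> pverts = V,
       parcs = {(x, y). x \<in> V \<and> y \<in> V \<and> (fst x = snd y \<or> fst y = snd x)} \<rparr>)"

lemma pverts_shift_graph:
  "pverts (shift_graph n) = {(x1, x2). 1 \<le> x1 \<and> x1 < x2 \<and> x2 \<le> n}"
  by (simp add: shift_graph_def Let_def)

lemma parcs_shift_graph:
  "parcs (shift_graph n) = {(x, y). x \<in> pverts (shift_graph n) \<and> y \<in> pverts (shift_graph n) \<and>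
     (fst x = snd y \<or> fst y = snd x)}"
  by (simp add: shift_graph_def Let_def)

lemma finite_pverts_shift_graph: "finite (pverts (shift_graph n))"
  by (rule finite_subset[of _ "{1..n} \<times> {1..n}"]) (auto simp: pverts_shift_graph)

lemma pair_graph_shift_graph: "pair_graph (shift_graph n)"
proof
  show "finite (parcs (shift_graph n))"
    by (rule finite_subset[of _ "pverts (shift_graph n) \<times> pverts (shift_graph n)"])
       (auto simp: parcs_shift_graph finite_pverts_shift_graph)
  show "symmetric (with_proj (shift_graph n))"
    by (auto simp: symmetric_def parcs_shift_graph intro!: symI)
qed (auto simp: parcs_shift_graph pverts_shift_graph finite_pverts_shift_graph[unfolded pverts_shift_graph])

definition independent_set :: "('a, 'b) pre_digraph \<Rightarrow> 'a set \<Rightarrow> bool" where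
  "independent_set H S \<longleftrightarrow> S \<subseteq> verts H \<and> (\<forall>u\<in>S. \<forall>v\<in>S. \<not> u \<rightarrow>\<^bsub>H\<^esub> v)"

text \<open>Meaningful only if the graph has finitely many vertices, since \<^const>\<open>Max\<close> is
  unspecified on infinite sets.\<close>
definition independence_number :: "('a, 'b) pre_digraph \<Rightarrow> nat" where
  "independence_number H = Max (card ` {S. independent_set H S})"

lemma independence_number_well_defined:
  assumes "finite (verts H)"
  shows "finite (card ` {S. independent_set H S})" and "card ` {S. independent_set H S} \<noteq> {}"
proof -
  have "{S. independent_set H S} \<subseteq> Pow (verts H)"
    by (auto simp: independent_set_def)
  then show "finite (card ` {S. independent_set H S})"
    using assms by (meson finite_Pow_iff finite_imageI finite_subset)
  have "independent_set H {}"
    by (simp add: independent_set_def)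
  then show "card ` {S. independent_set H S} \<noteq> {}"
    by blast
qed

end

theory Submission
  imports Defs
begin

text \<open>
  Colour the integers \<open>1, \<dots>, n\<close> with two colours and keep the pairs of \<open>G\<close> whose first entry lies in
  the colour class \<open>A\<close> and whose second entry does not. Two kept pairs are never adjacent, and for a
  uniformly random \<open>A\<close> each pair is kept with probability \<open>1/4\<close>.
\<close>

text \<open>Membership of \<open>x\<close> and of \<open>y\<close> is prescribed and all other
  elements are free, so these sets are \<open>x\<close> adjoined to an arbitrary subset of
  \<open>V - {x, y}\<close>. The factor 4 stands on the left to avoid \<open>card V - 2\<close> in
  the exponent.\<close>

lemma card_subsets_separating:
  assumes "finite V" "x \<in> V" "y \<in> V" "x \<noteq> y"
  shows "4 * card {A \<in> Pow V. x \<in> A \<and> y \<notin> A} = 2 ^ card V"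
proof -
  have "{A \<in> Pow V. x \<in> A \<and> y \<notin> A} = insert x ` Pow (V - {x, y})" (is "?L = ?R")
  proof
    show "?L \<subseteq> ?R"
    proof
      fix A assume "A \<in> ?L"
      then have "A = insert x (A - {x})" "A - {x} \<in> Pow (V - {x, y})"
        by auto
      then show "A \<in> ?R"
        by (rule image_eqI)
    qed
  qed (use assms in auto)
  moreover have "inj_on (insert x) (Pow (V - {x, y}))"
    by (rule inj_onI) (auto simp: insert_ident)
  ultimately have "card {A \<in> Pow V. x \<in> A \<and> y \<notin> A} = 2 ^ card (V - {x, y})"
    using assms(1) by (simp add: card_image card_Pow)
  moreover have "card V = card (V - {x, y}) + 2"
    using card_Diff_subset[of "{x, y}" V] card_mono[of V "{x, y}"] assms by simp
  ultimately show ?thesis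
    by (simp add: power_add)
qed

text \<open>An averaging argument: each pair is cut by exactly a quarter of all subsets of
  \<open>V\<close>, so the mean cut size is a quarter of \<open>card G\<close>, and not every cut
  can lie below the mean.\<close>

lemma exists_large_directed_cut:
  assumes "finite V" "G \<subseteq> V \<times> V" "\<And>x y. (x, y) \<in> G \<Longrightarrow> x \<noteq> y"
  shows "\<exists>A\<subseteq>V. card G \<le> 4 * card {(x, y) \<in> G. x \<in> A \<and> y \<notin> A}"
proof (rule ccontr)
  let ?c = "\<lambda>A. {(x, y) \<in> G. x \<in> A \<and> y \<notin> A}"
  assume "\<not> ?thesis"
  then have less: "4 * card (?c A) < card G" if "A \<in> Pow V" for A
    using that by (meson PowD not_le)
  have [simp]: "finite G"
    using assms(1,2) by (meson finite_SigmaI finite_subset)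
  have "(\<Sum>A\<in>Pow V. 4 * card (?c A)) = 4 * (\<Sum>A\<in>Pow V. card {e \<in> G. fst e \<in> A \<and> snd e \<notin> A})"
    by (simp add: sum_distrib_left case_prod_unfold)
  \<comment> \<open>Double counting of the incidences between subsets \<open>A\<close> and the pairs
    \<open>e\<close> they cut.\<close>
  also have "\<dots> = 4 * (\<Sum>e\<in>G. card {A \<in> Pow V. fst e \<in> A \<and> snd e \<notin> A})"
    using sum_multicount_gen[of "Pow V" G "\<lambda>A e. fst e \<in> A \<and> snd e \<notin> A"
        "\<lambda>e. card {A \<in> Pow V. fst e \<in> A \<and> snd e \<notin> A}"] assms(1) by simp
  also have "\<dots> = (\<Sum>e\<in>G. 2 ^ card V)"
    unfolding sum_distrib_left
    by (rule sum.cong) (use assms in \<open>auto simp del: Pow_iff intro!: card_subsets_separating\<close>)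
  also have "\<dots> = (\<Sum>A\<in>Pow V. card G)"
    using assms(1) by (simp add: card_Pow)
  finally have "(\<Sum>A\<in>Pow V. 4 * card (?c A)) = (\<Sum>A\<in>Pow V. card G)" .
  moreover have "(\<Sum>A\<in>Pow V. 4 * card (?c A)) < (\<Sum>A\<in>Pow V. card G)"
    by (rule sum_strict_mono) (use assms(1) less in auto)
  ultimately show False
    by simp
qed

lemma independence_number_ge:
  assumes "finite (verts H)" "independent_set H S"
  shows "card S \<le> independence_number H"
  unfolding independence_number_def
  using assms independence_number_well_defined(1) by (intro Max_ge) auto

theorem claim2p1:
  fixes n :: int and G :: "(int \<times> int) set"
  assumes "n > 2"
    and "G \<subseteq> verts (with_proj (shift_graph n))"
  shows "real (independence_number (with_proj (shift_graph n) \<restriction> G)) \<ge> 1 / 4 * real (card G)"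
proof -
  let ?H = "with_proj (shift_graph n) \<restriction> G"
  have G: "G \<subseteq> {(x, y). 1 \<le> x \<and> x < y \<and> y \<le> n}"
    using assms(2) by (simp add: pverts_shift_graph)
  \<comment> \<open>The pairs of \<open>G\<close> are arcs on \<open>{1..n}\<close>, loop-free
    because \<open>x < y\<close>.\<close>
  then obtain A where A: "card G \<le> 4 * card {(x, y) \<in> G. x \<in> A \<and> y \<notin> A}"
    using exists_large_directed_cut[of "{1..n}" G] by fastforce
  have "finite (verts ?H)"
    using assms(2) finite_pverts_shift_graph by (auto intro: finite_subset)
  \<comment> \<open>An adjacency would make the first entry of one kept pair the second entry of
    another, hence an integer both inside and outside \<open>A\<close>.\<close>
  moreover have "independent_set ?H {(x, y) \<in> G. x \<in> A \<and> y \<notin> A}"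
    by (auto simp: independent_set_def arcs_ends_def arc_to_ends_def parcs_shift_graph)
  ultimately have "card {(x, y) \<in> G. x \<in> A \<and> y \<notin> A} \<le> independence_number ?H"
    by (rule independence_number_ge)
  with A show ?thesis
    by linarith
qed

end
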